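(* Let $J:\mathbb{R}\to[0,\infty)$ be smooth, radially symmetric (even), with $\int_{\mathbb{R}}J=1$ and supported in $(-d,d)$, $d>0$. Let $u_0\ge0$ be bounded, with $u_0=0$ for $x<0$ and $\int_0^\infty u_0(x)(1+x)\,dx<\infty$. Let $u$ be the solution to $$u_t=J*u-u\ \ (x\ge0,\ t>0),\qquad u(x,t)=0\ \ (x<0,\ t>0),\qquad u(x,0)=u_0(x)\ \ (x\in\mathbb{R}),$$ and let $\phi$ be the solution to the stationary problem $$J*\phi=\phi\ \text{ for }x\ge0,\qquad \phi=0\ \text{ for }-d<x<0,\qquad (\phi(x)-x)\in L^\infty(\mathbb{R}_+).$$ Then, for every $t>0$, $$\int_0^\infty u(x,t)\phi(x)\,dx=\int_0^\infty u_0(x)\phi(x)\,dx.$$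
   Context: $\mathbb{R}_+=(0,\infty)$; convolution is in the space variable $x$. "Supported in $(-d,d)$" means $J(z)=0$ for $|z|\ge d$. $\phi$ is defined on $(-d,\infty)$. The solution $u$ is the unique solution in $C([0,\infty);L^1(\mathbb{R}_+,(1+x)\,dx))$. *)

theory Defs
  imports "HOL-Analysis.Analysis"
begin

definition smooth :: "(real \<Rightarrow> real) \<Rightarrow> bool" where
  "smooth f \<longleftrightarrow> (\<forall>n. (deriv ^^ n) f differentiable_on UNIV)"

definition conv :: "(real \<Rightarrow> real) \<Rightarrow> (real \<Rightarrow> real) \<Rightarrow> real \<Rightarrow> real" where
  "conv J f x = (LINT y|lebesgue. J (x - y) * f y)"

definition half_line :: "real measure" where
  "half_line = lebesgue_on {0<..}"

definition weighted_half_line :: "real measure" where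
  "weighted_half_line = density half_line (\<lambda>x. ennreal (1 + x))"

text \<open>Continuity of a curve \<open>v\<close> on the time set \<open>I\<close> with values in \<open>L\<^sup>1(M)\<close>; the elements of
  \<open>L\<^sup>1(M)\<close> are given by representatives.\<close>

definition continuous_into_L1 :: "'a measure \<Rightarrow> real set \<Rightarrow> (real \<Rightarrow> 'a \<Rightarrow> real) \<Rightarrow> bool" where
  "continuous_into_L1 M I v \<longleftrightarrow>
     (\<forall>t\<in>I. integrable M (v t)) \<and>
     (\<forall>t\<in>I. ((\<lambda>s. LINT x|M. \<bar>v s x - v t x\<bar>) \<longlongrightarrow> 0) (at t within I))"

definition in_L_infinity :: "'a measure \<Rightarrow> ('a \<Rightarrow> real) \<Rightarrow> bool" where
  "in_L_infinity M f \<longleftrightarrow> f \<in> borel_measurable M \<and> (\<exists>C. AE x in M. \<bar>f x\<bar> \<le> C)"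

definition evolution_solution ::
    "(real \<Rightarrow> real) \<Rightarrow> (real \<Rightarrow> real) \<Rightarrow> (real \<Rightarrow> real \<Rightarrow> real) \<Rightarrow> bool" where
  "evolution_solution J u0 u \<longleftrightarrow>
     continuous_into_L1 weighted_half_line {0..} (\<lambda>t x. u x t) \<and>
     (\<forall>x\<ge>0. \<forall>t>0. (u x has_real_derivative (conv J (\<lambda>y. u y t) x - u x t)) (at t)) \<and>
     (\<forall>x<0. \<forall>t>0. u x t = 0) \<and>
     (\<forall>x. u x 0 = u0 x)"

text \<open>The unknown \<open>\<phi>\<close> lives on \<open>(-d, \<infinity>)\<close>. It is encoded as a total function whose values on
  \<open>(-\<infinity>, -d]\<close> are unconstrained: for \<open>x \<ge> 0\<close> and \<open>J\<close> supported in \<open>(-d, d)\<close>,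
  \<open>conv J \<phi> x\<close> does not depend on them.\<close>

definition stationary_solution ::
    "(real \<Rightarrow> real) \<Rightarrow> real \<Rightarrow> (real \<Rightarrow> real) \<Rightarrow> bool" where
  "stationary_solution J d \<phi> \<longleftrightarrow>
     (\<forall>x\<ge>0. conv J \<phi> x = \<phi> x) \<and>
     (\<forall>x. -d < x \<and> x < 0 \<longrightarrow> \<phi> x = 0) \<and>
     in_L_infinity half_line (\<lambda>x. \<phi> x - x)"

end

theory Submission
  imports Defs
begin

text \<open>
  Write \<open>K\<close> for the truncated convolution \<open>(K w) x = \<integral>\<^sub>y\<^sub>>\<^sub>0 J (x - y) w y\<close>, called \<open>hconv\<close> below. On
  \<open>x > 0\<close> the evolution equation reads \<open>u\<^sub>t = K u - u\<close> and the stationary equation \<open>K \<phi> = \<phi>\<close>. As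
  \<open>J\<close> is even, \<open>K\<close> is symmetric, so that formally
  \<open>d/dt \<integral> u \<phi> = \<integral> (K u - u) \<phi> = \<integral> u (K \<phi> - \<phi>) = 0\<close>.

  The function \<open>\<phi>\<close> is unbounded, but \<open>\<phi> - x\<close> is bounded, so that \<open>\<phi>\<close> grows at most linearly and pairs
  continuously with the space \<open>L\<^sup>1((1 + x) dx)\<close> in which \<open>u\<close> moves (\<open>linear_growth_pairing\<close>). Since \<open>J\<close>
  has compact support, \<open>K\<close> preserves linear growth (\<open>linear_growth_hconv\<close>), and this bound is what
  justifies Fubini's theorem for the symmetry of \<open>K\<close> (\<open>hconv_adjoint\<close>).

  The time derivative of \<open>u\<close> exists only pointwise in \<open>x\<close>, with no bound that would allow
  differentiation under the integral. The equation is therefore integrated first. For fixed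
  \<open>x > 0\<close> the function \<open>e\<^sup>t u\<close> has the derivative \<open>e\<^sup>t K u\<close>, which is continuous in time because \<open>K\<close>
  turns the \<open>L\<^sup>1\<close>-continuous curve \<open>u\<close> into a function jointly continuous in \<open>(t, x)\<close>
  (\<open>hconv_jointly_continuous\<close>); the fundamental theorem of calculus gives an identity between the values
  at two positive times (\<open>variation_of_constants\<close>). Multiplying by \<open>\<phi>\<close>, integrating in \<open>x\<close> and
  exchanging the integrals shows that \<open>F t = \<integral> u \<phi>\<close> satisfies
  \<open>e\<^sup>t F t - e\<^sup>s F s = \<integral>\<^sub>s\<^sup>t e\<^sup>\<tau> F \<tau> d\<tau>\<close> (\<open>pairing_increment\<close>), which forces \<open>F\<close> to be constant on
  positive times (\<open>constant_if_exp_integral_equation\<close>). Time \<open>0\<close> is reached by \<open>L\<^sup>1\<close>-continuity alone.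
\<close>

section \<open>The weighted half-line\<close>

lemma space_half_line [simp]: "space half_line = {0<..}"
  by (simp add: half_line_def)

text \<open>Fubini's theorem is applied to products with this measure.\<close>

lemma sigma_finite_half_line: "sigma_finite_measure half_line"
proof -
  obtain A :: "real set set" where A: "countable A" "A \<subseteq> sets lborel" "\<Union>A = space lborel"
    "\<forall>a\<in>A. emeasure lborel a \<noteq> \<infinity>"
    using lborel.sigma_finite_countable by blast
  have "sigma_finite_measure (lebesgue :: real measure)"
    by standard (intro exI[of _ A], use A in auto)
  then show ?thesis
    unfolding half_line_def by (rule sigma_finite_measure_restrict_space) simp
qed

lemma measurable_ident_half_line [measurable]: "(\<lambda>x. x) \<in> borel_measurable half_line"
  unfolding half_line_def by (intro measurable_restrict_space1 measurable_completion) simp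

lemma integrable_dominated:
  fixes f g :: "'a \<Rightarrow> real"
  assumes f: "integrable M f" and g: "g \<in> borel_measurable M" and le: "AE x in M. \<bar>g x\<bar> \<le> f x"
  shows "integrable M g"
  using f g
proof (rule Bochner_Integration.integrable_bound)
  show "AE x in M. norm (g x) \<le> norm (f x)"
    using le by eventually_elim simp
qed

lemma measurable_weighted_half_line [simp]:
  "borel_measurable weighted_half_line = borel_measurable half_line"
  unfolding weighted_half_line_def by (rule measurable_cong_sets) auto

lemma integral_weighted_half_line:
  assumes w: "w \<in> borel_measurable half_line"
  shows "(LINT x|weighted_half_line. w x) = (LINT x|half_line. (1 + x) * w x)"
    and "integrable weighted_half_line w \<longleftrightarrow> integrable half_line (\<lambda>x. (1 + x) * w x)"
proof -
  have m: "(\<lambda>x. 1 + x) \<in> borel_measurable half_line" by measurable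
  have p: "AE x in half_line. 0 \<le> 1 + x" by (rule AE_I2) simp
  show "(LINT x|weighted_half_line. w x) = (LINT x|half_line. (1 + x) * w x)"
    unfolding weighted_half_line_def by (rule integral_real_density[OF m p w])
  show "integrable weighted_half_line w \<longleftrightarrow> integrable half_line (\<lambda>x. (1 + x) * w x)"
    unfolding weighted_half_line_def by (rule integrable_real_density[OF m p w])
qed

text \<open>These functions, with \<open>C\<close> as a bound of the norm, form the dual of \<open>L\<^sup>1((1 + x) dx)\<close> under the
  unweighted pairing \<open>\<integral> w g dx\<close>.\<close>

definition linear_growth :: "real \<Rightarrow> (real \<Rightarrow> real) \<Rightarrow> bool" where
  "linear_growth C g \<longleftrightarrow>
     0 \<le> C \<and> g \<in> borel_measurable half_line \<and> (AE x in half_line. \<bar>g x\<bar> \<le> C * (1 + x))"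

lemma linear_growth_pairing:
  assumes w: "integrable weighted_half_line w" and g: "linear_growth C g"
  shows "integrable half_line (\<lambda>x. w x * g x)"
    and "\<bar>LINT x|half_line. w x * g x\<bar> \<le> C * (LINT x|weighted_half_line. \<bar>w x\<bar>)"
proof -
  have [measurable]: "w \<in> borel_measurable half_line" "g \<in> borel_measurable half_line"
    and bd: "AE x in half_line. \<bar>g x\<bar> \<le> C * (1 + x)"
    using borel_measurable_integrable[OF w] g
    by (auto simp: linear_growth_def)
  have dom: "integrable half_line (\<lambda>x. C * ((1 + x) * \<bar>w x\<bar>))"
    using integrable_abs[OF w] by (intro integrable_mult_right) (simp add: integral_weighted_half_line(2))
  have le: "AE x in half_line. \<bar>w x * g x\<bar> \<le> C * ((1 + x) * \<bar>w x\<bar>)"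
    using bd
  proof eventually_elim
    case (elim x)
    show ?case
      using mult_left_mono[OF elim, of "\<bar>w x\<bar>"] by (simp add: abs_mult algebra_simps)
  qed
  show int: "integrable half_line (\<lambda>x. w x * g x)"
    by (rule integrable_dominated[OF dom _ le]) measurable
  have "\<bar>LINT x|half_line. w x * g x\<bar> \<le> (LINT x|half_line. \<bar>w x * g x\<bar>)"
    by (rule integral_abs_bound)
  also have "\<dots> \<le> (LINT x|half_line. C * ((1 + x) * \<bar>w x\<bar>))"
    by (rule integral_mono_AE[OF integrable_abs[OF int] dom le])
  also have "\<dots> = C * (LINT x|weighted_half_line. \<bar>w x\<bar>)"
    using integral_weighted_half_line(1)[of "\<lambda>x. \<bar>w x\<bar>"] by simp
  finally show "\<bar>LINT x|half_line. w x * g x\<bar> \<le> C * (LINT x|weighted_half_line. \<bar>w x\<bar>)" .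
qed

section \<open>Continuous curves in the weighted space\<close>

lemma continuous_into_L1_within:
  assumes v: "continuous_into_L1 M I v" and t: "t \<in> I"
  shows "continuous (at t within I) (\<lambda>s. LINT x|M. \<bar>v s x - v t x\<bar>)"
  using assms by (simp add: continuous_within continuous_into_L1_def)

lemma continuous_on_L1_bounded_functional:
  fixes \<Phi> :: "('a \<Rightarrow> real) \<Rightarrow> real"
  assumes v: "continuous_into_L1 M I v"
    and \<Phi>: "\<And>s t. s \<in> I \<Longrightarrow> t \<in> I \<Longrightarrow>
      \<bar>\<Phi> (v s) - \<Phi> (v t)\<bar> \<le> C * (LINT x|M. \<bar>v s x - v t x\<bar>)"
  shows "continuous_on I (\<lambda>t. \<Phi> (v t))"
  unfolding continuous_on_def
proof
  fix t assume t: "t \<in> I"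
  have "\<forall>\<^sub>F s in at t within I. norm (\<Phi> (v s) - \<Phi> (v t)) \<le> C * (LINT x|M. \<bar>v s x - v t x\<bar>)"
    unfolding eventually_at_filter using \<Phi> t by (intro always_eventually) auto
  moreover have "((\<lambda>s. C * (LINT x|M. \<bar>v s x - v t x\<bar>)) \<longlongrightarrow> 0) (at t within I)"
    using v t by (intro tendsto_mult_right_zero) (simp add: continuous_into_L1_def)
  ultimately have "((\<lambda>s. \<Phi> (v s) - \<Phi> (v t)) \<longlongrightarrow> 0) (at t within I)"
    by (rule Lim_null_comparison)
  then show "((\<lambda>s. \<Phi> (v s)) \<longlongrightarrow> \<Phi> (v t)) (at t within I)"
    by (rule LIM_zero_cancel)
qed

text \<open>This gives a bound of the norm that is uniform on compact time intervals.\<close>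

lemma continuous_on_L1_norm:
  assumes v: "continuous_into_L1 M I v"
  shows "continuous_on I (\<lambda>t. LINT x|M. \<bar>v t x\<bar>)"
proof (rule continuous_on_L1_bounded_functional[OF v])
  fix s t assume st: "s \<in> I" "t \<in> I"
  then have int: "integrable M (v s)" "integrable M (v t)"
    using v by (simp_all add: continuous_into_L1_def)
  have "(LINT x|M. \<bar>v s x\<bar>) - (LINT x|M. \<bar>v t x\<bar>) = (LINT x|M. \<bar>v s x\<bar> - \<bar>v t x\<bar>)"
    by (rule Bochner_Integration.integral_diff[symmetric]) (use int in auto)
  moreover have "\<bar>LINT x|M. \<bar>v s x\<bar> - \<bar>v t x\<bar>\<bar> \<le> (LINT x|M. \<bar>v s x - v t x\<bar>)"
    by (rule order_trans[OF integral_abs_bound]) (rule integral_mono, use int in auto)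
  ultimately show "\<bar>(LINT x|M. \<bar>v s x\<bar>) - (LINT x|M. \<bar>v t x\<bar>)\<bar> \<le> 1 * (LINT x|M. \<bar>v s x - v t x\<bar>)"
    by simp
qed

lemma continuous_on_linear_growth_pairing:
  assumes v: "continuous_into_L1 weighted_half_line I v" and g: "linear_growth C g"
  shows "continuous_on I (\<lambda>t. LINT x|half_line. v t x * g x)"
proof (rule continuous_on_L1_bounded_functional[OF v])
  fix s t assume st: "s \<in> I" "t \<in> I"
  then have int: "integrable weighted_half_line (v s)" "integrable weighted_half_line (v t)"
    using v by (simp_all add: continuous_into_L1_def)
  have "(LINT x|half_line. v s x * g x) - (LINT x|half_line. v t x * g x)
      = (LINT x|half_line. (v s x - v t x) * g x)"
    using linear_growth_pairing(1)[OF int(1) g] linear_growth_pairing(1)[OF int(2) g]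
    by (simp add: left_diff_distrib)
  then show "\<bar>(LINT x|half_line. v s x * g x) - (LINT x|half_line. v t x * g x)\<bar>
      \<le> C * (LINT x|weighted_half_line. \<bar>v s x - v t x\<bar>)"
    using linear_growth_pairing(2)[OF Bochner_Integration.integrable_diff[OF int] g]
    by simp
qed

section \<open>Convolution on the half-line\<close>

text \<open>The derivative is bounded on the compact set \<open>[-d, d]\<close> and vanishes outside it, where \<open>J\<close> is
  locally zero.\<close>

lemma smooth_compact_support_lipschitz:
  assumes "smooth J" and supp: "\<And>z. \<bar>z\<bar> \<ge> d \<Longrightarrow> J z = 0"
  obtains L where "L-lipschitz_on UNIV J"
proof -
  have dJ: "J differentiable_on UNIV" and ddJ: "deriv J differentiable_on UNIV"
    using \<open>smooth J\<close>[unfolded smooth_def, rule_format, of 0]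
      \<open>smooth J\<close>[unfolded smooth_def, rule_format, of 1] by simp_all
  have "compact (deriv J ` {-d..d})"
    using ddJ by (intro compact_continuous_image)
      (auto intro: continuous_on_subset differentiable_imp_continuous_on)
  then obtain B where B: "\<And>z. z \<in> {-d..d} \<Longrightarrow> \<bar>deriv J z\<bar> \<le> B"
    by (fastforce dest!: compact_imp_bounded simp: bounded_iff)
  have out: "deriv J z = 0" if "\<bar>z\<bar> > d" for z
  proof -
    have "eventually (\<lambda>y. y \<in> {y. d < \<bar>y\<bar>}) (nhds z)"
      by (rule eventually_nhds_in_open) (use that in \<open>auto intro!: open_Collect_less continuous_intros\<close>)
    then have "eventually (\<lambda>y. J y = 0) (nhds z)"
      by eventually_elim (simp add: supp)
    then have "deriv J z = deriv (\<lambda>_. 0) z"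
      by (intro deriv_cong_ev) auto
    then show ?thesis by simp
  qed
  have bd: "\<bar>deriv J z\<bar> \<le> max B 0" for z
  proof (cases "\<bar>z\<bar> \<le> d")
    case True
    then have "z \<in> {-d..d}" by auto
    then show ?thesis using B[of z] by simp
  qed (simp add: out)
  have "(max B 0)-lipschitz_on UNIV J"
  proof (rule lipschitz_onI)
    fix x y :: real
    have "(J has_field_derivative deriv J z) (at z)" for z
      using dJ by (simp add: DERIV_deriv_iff_real_differentiable differentiable_on_def)
    then have "norm (J x - J y) \<le> max B 0 * norm (x - y)"
      using bd by (intro field_differentiable_bound[of UNIV J "deriv J"]) auto
    then show "dist (J x) (J y) \<le> max B 0 * dist x y"
      by (simp add: dist_real_def)
  qed auto
  then show ?thesis by (rule that)
qed

locale lipschitz_kernel =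
  fixes J :: "real \<Rightarrow> real" and d L :: real
  assumes nonneg: "\<And>z. J z \<ge> 0"
    and even: "\<And>z. J (- z) = J z"
    and mass: "(LINT z|lebesgue. J z) = 1"
    and d_pos: "d > 0"
    and support: "\<And>z. \<bar>z\<bar> \<ge> d \<Longrightarrow> J z = 0"
    and lipschitz: "L-lipschitz_on UNIV J"
begin

definition hconv :: "(real \<Rightarrow> real) \<Rightarrow> real \<Rightarrow> real" where
  "hconv w x = (LINT y|half_line. J (x - y) * w y)"

lemma L_nonneg: "0 \<le> L"
  using lipschitz by (rule lipschitz_on_nonneg)

lemma borel_J [measurable]: "J \<in> borel_measurable borel"
  by (intro borel_measurable_continuous_onI lipschitz_on_continuous_on[OF lipschitz])

lemma J_diff_le: "\<bar>J x - J y\<bar> \<le> L * \<bar>x - y\<bar>"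
  using lipschitz_onD[OF lipschitz, of x y] by (simp add: dist_real_def)

lemma J_commute: "J (x - y) = J (y - x)"
  using even[of "x - y"] by simp

text \<open>Compare with \<open>J d = 0\<close>.\<close>

lemma J_le: "J z \<le> 2 * d * L"
proof (cases "\<bar>z\<bar> < d")
  case True
  have "J z \<le> L * \<bar>z - d\<bar>"
    using J_diff_le[of z d] support[of d] d_pos by simp
  also have "\<dots> \<le> L * (2 * d)"
    using True by (intro mult_left_mono L_nonneg) auto
  finally show ?thesis by (simp add: mult_ac)
qed (use support[of z] L_nonneg d_pos in simp)

text \<open>Only an inequality holds on the half-line: for \<open>y < d\<close> part of the mass may lie at negative \<open>x\<close>.\<close>

lemma translated_kernel_mass:
  shows "integrable half_line (\<lambda>x. J (y - x))" and "(LINT x|half_line. J (y - x)) \<le> 1"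
proof -
  \<comment> \<open>The integral of a non-integrable function is \<open>0\<close>, so the mass \<open>1\<close> forces integrability.\<close>
  have "integrable lebesgue J"
    using mass not_integrable_integral_eq[of lebesgue J] by fastforce
  then have J: "integrable lborel J" "integral\<^sup>L lborel J = 1"
    using mass by (simp_all add: integrable_completion integral_completion)
  have "integrable lborel (\<lambda>x. J (y + (-1) * x))"
    using J(1) by (rule lborel_integrable_real_affine) simp
  moreover have "(LINT x|lborel. J (y + (-1) * x)) = 1"
    using lborel_integral_real_affine[of "-1" J y] J(2) by simp
  ultimately have *: "integrable lebesgue (\<lambda>x. J (y - x))" "(LINT x|lebesgue. J (y - x)) = 1"
    by (simp_all add: integrable_completion integral_completion)
  have "integrable lebesgue (\<lambda>x. indicator {0<..} x *\<^sub>R J (y - x))"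
    using *(1) by (rule integrable_mult_indicator[rotated]) simp
  then show "integrable half_line (\<lambda>x. J (y - x))"
    by (simp add: half_line_def integrable_restrict_space)
  have "(LINT x|lebesgue. indicator {0<..} x *\<^sub>R J (y - x)) \<le> (LINT x|lebesgue. J (y - x))"
    using *(1) \<open>integrable lebesgue (\<lambda>x. indicator {0<..} x *\<^sub>R J (y - x))\<close>
    by (intro integral_mono) (auto simp: indicator_def nonneg)
  then show "(LINT x|half_line. J (y - x)) \<le> 1"
    using *(2) by (simp add: half_line_def integral_restrict_space)
qed

text \<open>The two integrals differ by the negative half-line, where the integrand vanishes, and by the null set
  \<open>{0}\<close>, where \<open>f\<close> is arbitrary.\<close>

lemma conv_eq_hconv:
  assumes [measurable]: "f \<in> borel_measurable half_line"
    and zero: "\<And>y. y < 0 \<Longrightarrow> J (x - y) * f y = 0"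
  shows "conv J f x = hconv f x"
proof -
  let ?g = "\<lambda>y. indicator {0<..} y *\<^sub>R (J (x - y) * f y)"
  have "(\<lambda>y. J (x - y) * f y) \<in> borel_measurable half_line"
    by measurable
  then have m: "?g \<in> borel_measurable lebesgue"
    by (simp add: half_line_def borel_measurable_restrict_space_iff)
  have eq: "(\<lambda>y. J (x - y) * f y) = (\<lambda>y. ?g y + indicator {0} y * (J x * f 0))"
  proof
    fix y :: real
    consider "y < 0" | "y = 0" | "0 < y" by linarith
    then show "J (x - y) * f y = ?g y + indicator {0} y * (J x * f 0)"
      by cases (use zero[of y] in auto)
  qed
  have "AE y in lebesgue. J (x - y) * f y = ?g y"
  proof (rule AE_I'[of "{0}"])
    show "{0::real} \<in> null_sets lebesgue" by simp
    show "{y \<in> space lebesgue. J (x - y) * f y \<noteq> ?g y} \<subseteq> {0}"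
    proof
      fix y assume y: "y \<in> {y \<in> space lebesgue. J (x - y) * f y \<noteq> ?g y}"
      then have "J (x - y) * f y \<noteq> ?g y" by simp
      then show "y \<in> {0}"
        using zero[of y] by (cases y "0 :: real" rule: linorder_cases) auto
    qed
  qed
  then have "conv J f x = (LINT y|lebesgue. ?g y)"
    unfolding conv_def
  proof (intro integral_cong_AE)
    have "(\<lambda>y. indicator {0} y * (J x * f 0)) \<in> borel_measurable lebesgue"
      by (intro borel_measurable_times borel_measurable_indicator borel_measurable_const) simp
    then show "(\<lambda>y. J (x - y) * f y) \<in> borel_measurable lebesgue"
      unfolding eq by (rule borel_measurable_add[OF m])
  qed (rule m)
  then show ?thesis
    by (simp add: hconv_def half_line_def integral_restrict_space)
qed

text \<open>The second bound is small for \<open>x'\<close> near \<open>x\<close>: \<open>J\<close> being Lipschitz, translating the kernel is continuous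
  in the dual norm. Both bounds enter the joint continuity of \<open>K v\<close>.\<close>

lemma linear_growth_kernel:
  shows "linear_growth (2 * d * L) (\<lambda>y. J (x - y))"
    and "linear_growth (L * \<bar>x - x'\<bar>) (\<lambda>y. J (x - y) - J (x' - y))"
proof -
  have *: "C \<le> C * (1 + y)" if "0 \<le> C" "0 < y" for C y :: real
    using that by (simp add: distrib_left)
  have "J (x - y) \<le> 2 * d * L * (1 + y)" if "0 < y" for y
    by (rule order_trans[OF J_le *]) (use that L_nonneg d_pos in auto)
  then show "linear_growth (2 * d * L) (\<lambda>y. J (x - y))"
    using L_nonneg d_pos by (auto simp: linear_growth_def nonneg intro!: AE_I2)
  have "\<bar>J (x - y) - J (x' - y)\<bar> \<le> L * \<bar>x - x'\<bar> * (1 + y)" if "0 < y" for y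
    using J_diff_le[of "x - y" "x' - y"] *[of "L * \<bar>x - x'\<bar>" y] that L_nonneg by simp
  then show "linear_growth (L * \<bar>x - x'\<bar>) (\<lambda>y. J (x - y) - J (x' - y))"
    using L_nonneg by (auto simp: linear_growth_def intro!: AE_I2)
qed

text \<open>Changing \<open>t\<close> costs at most \<open>2 d L\<close> times the \<open>L\<^sup>1\<close>-distance of the curve values, and changing \<open>x\<close>
  costs at most \<open>L \<bar>x - x'\<bar>\<close> times the norm of one value. Joint continuity makes \<open>K v\<close> Borel
  measurable in time and space together, as Fubini's theorem requires.\<close>

lemma hconv_jointly_continuous:
  assumes v: "continuous_into_L1 weighted_half_line I v"
  shows "continuous_on (I \<times> UNIV) (\<lambda>(t, x). hconv (v t) x)"
  unfolding continuous_on_def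
proof safe
  fix t x :: real assume t: "t \<in> I"
  let ?N = "\<lambda>w. LINT y|weighted_half_line. \<bar>w y\<bar>"
  let ?b = "\<lambda>p. 2 * d * L * ?N (\<lambda>y. v (fst p) y - v t y) + L * \<bar>snd p - x\<bar> * ?N (v t)"
  have int: "integrable weighted_half_line (v s)" if "s \<in> I" for s
    using v that by (simp add: continuous_into_L1_def)
  have le: "\<bar>hconv (v s) z - hconv (v t) x\<bar> \<le> ?b (s, z)" if s: "s \<in> I" for s z
  proof -
    note P = linear_growth_pairing
    note st = Bochner_Integration.integrable_diff[OF int[OF s] int[OF t]]
    have "hconv (v s) z - hconv (v t) x
        = (LINT y|half_line. (v s y - v t y) * J (z - y))
          + (LINT y|half_line. v t y * (J (z - y) - J (x - y)))"
      using P(1)[OF int[OF s] linear_growth_kernel(1)[of z]]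
        P(1)[OF int[OF t] linear_growth_kernel(1)[of z]]
        P(1)[OF int[OF t] linear_growth_kernel(1)[of x]]
      by (simp add: hconv_def left_diff_distrib right_diff_distrib mult.commute[of "J _"])
    moreover have "\<bar>LINT y|half_line. (v s y - v t y) * J (z - y)\<bar> \<le> 2 * d * L * ?N (\<lambda>y. v s y - v t y)"
      by (rule P(2)[OF st linear_growth_kernel(1)])
    moreover have "\<bar>LINT y|half_line. v t y * (J (z - y) - J (x - y))\<bar> \<le> L * \<bar>z - x\<bar> * ?N (v t)"
      by (rule P(2)[OF int[OF t] linear_growth_kernel(2)])
    ultimately show ?thesis by simp
  qed
  have "continuous (at (t, x) within I \<times> UNIV) (\<lambda>p. ?N (\<lambda>y. v (fst p) y - v t y))"
    by (rule continuous_within_compose2[where f = fst and g = "\<lambda>s. ?N (\<lambda>y. v s y - v t y)"])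
      (use continuous_into_L1_within[OF v t] in \<open>auto intro: continuous_intros simp: fst_image_times\<close>)
  then have "continuous (at (t, x) within I \<times> UNIV) ?b"
    by (intro continuous_intros)
  then have "(?b \<longlongrightarrow> 0) (at (t, x) within I \<times> UNIV)"
    by (simp add: continuous_within)
  moreover have "\<forall>\<^sub>F p in at (t, x) within I \<times> UNIV.
      norm ((case p of (s, z) \<Rightarrow> hconv (v s) z) - hconv (v t) x) \<le> ?b p"
    unfolding eventually_at_filter using le by (intro always_eventually) auto
  ultimately have "((\<lambda>p. (case p of (s, z) \<Rightarrow> hconv (v s) z) - hconv (v t) x) \<longlongrightarrow> 0) (at (t, x) within I \<times> UNIV)"
    by (rule Lim_null_comparison[rotated])
  then show "((\<lambda>(s, z). hconv (v s) z) \<longlongrightarrow> hconv (v t) x) (at (t, x) within I \<times> UNIV)"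
    by (rule LIM_zero_cancel)
qed

text \<open>On the support of \<open>J (y - x)\<close> one has \<open>1 + x \<le> 1 + y + d \<le> (1 + d) (1 + y)\<close>, so the growth of \<open>g\<close>
  is only magnified by a factor \<open>1 + d\<close>.\<close>

lemma hconv_linear_growth:
  assumes g: "linear_growth C g" and y: "0 < y"
  shows "integrable half_line (\<lambda>x. J (y - x) * g x)"
    and "\<bar>hconv g y\<bar> \<le> C * (1 + d) * (1 + y)"
proof -
  have [measurable]: "g \<in> borel_measurable half_line" and C: "0 \<le> C"
    and bd: "AE x in half_line. \<bar>g x\<bar> \<le> C * (1 + x)"
    using g by (auto simp: linear_growth_def)
  have dom: "integrable half_line (\<lambda>x. C * (1 + d) * (1 + y) * J (y - x))"
    by (intro integrable_mult_right translated_kernel_mass)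
  have le: "AE x in half_line. \<bar>J (y - x) * g x\<bar> \<le> C * (1 + d) * (1 + y) * J (y - x)"
    using bd
  proof eventually_elim
    case (elim x)
    show ?case
    proof (cases "\<bar>y - x\<bar> < d")
      case True
      have "\<bar>g x\<bar> \<le> C * (1 + x)" by (rule elim)
      also have "C * (1 + x) \<le> C * ((1 + d) * (1 + y))"
      proof (rule mult_left_mono[OF _ C])
        have "1 + x \<le> 1 + d + y" using True by simp
        also have "\<dots> \<le> (1 + d) * (1 + y)"
          using d_pos y by (simp add: algebra_simps)
        finally show "1 + x \<le> (1 + d) * (1 + y)" .
      qed
      finally have "\<bar>g x\<bar> * J (y - x) \<le> C * ((1 + d) * (1 + y)) * J (y - x)"
        by (rule mult_right_mono) (rule nonneg)
      then show ?thesis by (simp add: abs_mult nonneg mult_ac)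
    qed (simp add: support)
  qed
  show int: "integrable half_line (\<lambda>x. J (y - x) * g x)"
    by (rule integrable_dominated[OF dom _ le]) measurable
  have "\<bar>hconv g y\<bar> \<le> (LINT x|half_line. \<bar>J (y - x) * g x\<bar>)"
    unfolding hconv_def by (rule integral_abs_bound)
  also have "\<dots> \<le> (LINT x|half_line. C * (1 + d) * (1 + y) * J (y - x))"
    by (rule integral_mono_AE[OF integrable_abs[OF int] dom le])
  also have "\<dots> = C * (1 + d) * (1 + y) * (LINT x|half_line. J (y - x))"
    by simp
  also have "\<dots> \<le> C * (1 + d) * (1 + y) * 1"
    using C d_pos y by (intro mult_left_mono translated_kernel_mass) auto
  finally show "\<bar>hconv g y\<bar> \<le> C * (1 + d) * (1 + y)" by simp
qed

lemma linear_growth_hconv: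
  assumes g: "linear_growth C g"
  shows "linear_growth (C * (1 + d)) (hconv g)"
proof -
  interpret sigma_finite_measure half_line by (rule sigma_finite_half_line)
  have [measurable]: "g \<in> borel_measurable half_line" and C: "0 \<le> C"
    using g by (auto simp: linear_growth_def)
  have "hconv g \<in> borel_measurable half_line"
    unfolding hconv_def by measurable
  then show ?thesis
    using hconv_linear_growth(2)[OF g] C d_pos by (auto simp: linear_growth_def intro!: AE_I2)
qed

text \<open>Evenness of \<open>J\<close> makes the kernel \<open>J (x - y)\<close> symmetric. Integrability of the double integrand is
  checked by integrating in the variable of \<open>g\<close> first, which leaves \<open>w\<close> paired with a function of
  linear growth.\<close>

lemma hconv_adjoint:
  assumes w: "integrable weighted_half_line w" and g: "linear_growth C g"
  shows "integrable half_line (\<lambda>x. hconv w x * g x)"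
    and "(LINT x|half_line. hconv w x * g x) = (LINT y|half_line. w y * hconv g y)"
proof -
  interpret H: sigma_finite_measure half_line by (rule sigma_finite_half_line)
  interpret HH: pair_sigma_finite half_line half_line ..
  have [measurable]: "g \<in> borel_measurable half_line" "w \<in> borel_measurable half_line"
    using g borel_measurable_integrable[OF w]
    by (auto simp: linear_growth_def)
  have ga: "linear_growth C (\<lambda>x. \<bar>g x\<bar>)"
    using g by (auto simp: linear_growth_def)
  have "integrable (half_line \<Otimes>\<^sub>M half_line) (\<lambda>(y, x). w y * (J (y - x) * g x))"
  proof (rule HH.Fubini_integrable)
    have "integrable half_line (\<lambda>y. \<bar>w y\<bar> * hconv (\<lambda>x. \<bar>g x\<bar>) y)"
      using linear_growth_pairing(1)[OF integrable_abs[OF w] linear_growth_hconv[OF ga]] .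
    then show "integrable half_line (\<lambda>y. LINT x|half_line. norm (case (y, x) of (y, x) \<Rightarrow> w y * (J (y - x) * g x)))"
      by (simp add: hconv_def abs_mult nonneg)
    show "AE y in half_line. integrable half_line (\<lambda>x. case (y, x) of (y, x) \<Rightarrow> w y * (J (y - x) * g x))"
      using hconv_linear_growth(1)[OF g] by (intro AE_I2) simp
  qed measurable
  note int = this
  have *: "(LINT y|half_line. w y * (J (y - x) * g x)) = hconv w x * g x" for x
    unfolding hconv_def by (simp add: J_commute[of x] mult_ac flip: integral_mult_left_zero)
  show "integrable half_line (\<lambda>x. hconv w x * g x)"
    using HH.integrable_snd[OF int] by (simp add: *)
  show "(LINT x|half_line. hconv w x * g x) = (LINT y|half_line. w y * hconv g y)"
    using HH.Fubini_integral[OF int] by (simp add: *) (simp add: hconv_def)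
qed

text \<open>Symmetry for \<open>\<bar>w\<bar>\<close> and \<open>\<bar>g\<bar>\<close> moves \<open>K\<close> from \<open>w\<close> to \<open>g\<close>, where it preserves linear growth. The
  bound depends on \<open>w\<close> only through its norm, hence is uniform in time along a continuous curve.\<close>

lemma hconv_pairing_abs_le:
  assumes w: "integrable weighted_half_line w" and g: "linear_growth C g"
  shows "(LINT x|half_line. \<bar>hconv w x * g x\<bar>) \<le> C * (1 + d) * (LINT x|weighted_half_line. \<bar>w x\<bar>)"
proof -
  have ga: "linear_growth C (\<lambda>x. \<bar>g x\<bar>)"
    using g by (auto simp: linear_growth_def)
  note wa = integrable_abs[OF w]
  have "(LINT x|half_line. \<bar>hconv w x * g x\<bar>) \<le> (LINT x|half_line. hconv (\<lambda>y. \<bar>w y\<bar>) x * \<bar>g x\<bar>)"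
  proof (rule integral_mono)
    fix x
    have "\<bar>hconv w x\<bar> \<le> hconv (\<lambda>y. \<bar>w y\<bar>) x"
      unfolding hconv_def by (rule order_trans[OF integral_abs_bound]) (simp add: abs_mult nonneg)
    then show "\<bar>hconv w x * g x\<bar> \<le> hconv (\<lambda>y. \<bar>w y\<bar>) x * \<bar>g x\<bar>"
      by (simp add: abs_mult mult_right_mono)
  qed (use hconv_adjoint(1)[OF w g] hconv_adjoint(1)[OF wa ga] in auto)
  also have "\<dots> = (LINT y|half_line. \<bar>w y\<bar> * hconv (\<lambda>x. \<bar>g x\<bar>) y)"
    by (rule hconv_adjoint(2)[OF wa ga])
  also have "\<dots> \<le> C * (1 + d) * (LINT x|weighted_half_line. \<bar>\<bar>w x\<bar>\<bar>)"
    using linear_growth_pairing(2)[OF wa linear_growth_hconv[OF ga]] by simp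
  finally show ?thesis by simp
qed

section \<open>Conservation of the pairing\<close>

lemma stationary_linear_growth:
  assumes "stationary_solution J d \<phi>"
  obtains C where "linear_growth C \<phi>"
proof -
  obtain C where m: "(\<lambda>x. \<phi> x - x) \<in> borel_measurable half_line"
    and C: "AE x in half_line. \<bar>\<phi> x - x\<bar> \<le> C"
    using assms by (auto simp: stationary_solution_def in_L_infinity_def)
  have "(\<lambda>x. (\<phi> x - x) + x) \<in> borel_measurable half_line"
    by (intro borel_measurable_add m) measurable
  moreover have "AE x in half_line. \<bar>\<phi> x\<bar> \<le> max C 1 * (1 + x)"
    using C AE_space
  proof eventually_elim
    case (elim x)
    have "\<bar>\<phi> x\<bar> \<le> max C 1 * 1 + 1 * x" using elim by auto
    also have "\<dots> \<le> max C 1 * 1 + max C 1 * x"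
      using elim by (intro add_left_mono mult_right_mono) auto
    finally show ?case by (simp add: distrib_left)
  qed
  ultimately show ?thesis
    by (intro that[of "max C 1"]) (auto simp: linear_growth_def)
qed

text \<open>For \<open>x > 0\<close> the kernel \<open>J (x - y)\<close> does not reach the values of \<open>\<phi>\<close> on \<open>(-\<infinity>, -d]\<close>, and \<open>\<phi>\<close>
  vanishes on \<open>(-d, 0)\<close>.\<close>

lemma stationary_hconv:
  assumes "stationary_solution J d \<phi>" and x: "0 < x"
  shows "hconv \<phi> x = \<phi> x"
proof -
  obtain C where "linear_growth C \<phi>"
    using assms(1) by (rule stationary_linear_growth)
  moreover have "J (x - y) * \<phi> y = 0" if "y < 0" for y
  proof (cases "y \<le> - d")
    case True
    then show ?thesis using support[of "x - y"] x d_pos by simp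
  next
    case False
    then show ?thesis using assms(1) that by (simp add: stationary_solution_def)
  qed
  ultimately have "conv J \<phi> x = hconv \<phi> x"
    by (intro conv_eq_hconv) (auto simp: linear_growth_def)
  then show ?thesis
    using assms by (simp add: stationary_solution_def)
qed

text \<open>The factor \<open>e\<^sup>t\<close> absorbs the term \<open>-u\<close>: the derivative of \<open>e\<^sup>t u\<close> is continuous in \<open>t\<close> and contains
  only \<open>K u\<close>, which is jointly measurable, whereas for \<open>u\<close> itself this is not known a priori. The case \<open>s = 0\<close> is
  excluded because \<open>u x\<close> need not be continuous at time \<open>0\<close> for an individual \<open>x\<close>.\<close>

lemma variation_of_constants:
  assumes u: "evolution_solution J u0 u" and x: "0 < x" and s: "0 < s" "s \<le> t"
  shows "exp t * u x t - exp s * u x s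
     = (LINT \<tau>|restrict_space lborel {s..t}. exp \<tau> * hconv (\<lambda>y. u y \<tau>) x)"
proof -
  have cu: "continuous_into_L1 weighted_half_line {0..} (\<lambda>t x. u x t)"
    and neg: "\<And>x t. x < 0 \<Longrightarrow> t > 0 \<Longrightarrow> u x t = 0"
    using u by (auto simp: evolution_solution_def)
  have conv: "conv J (\<lambda>y. u y \<tau>) x = hconv (\<lambda>y. u y \<tau>) x" if "0 < \<tau>" for \<tau>
  proof (rule conv_eq_hconv)
    have "integrable weighted_half_line (\<lambda>y. u y \<tau>)"
      using cu that by (simp add: continuous_into_L1_def)
    then have "(\<lambda>y. u y \<tau>) \<in> borel_measurable weighted_half_line"
      by (rule borel_measurable_integrable)
    then show "(\<lambda>y. u y \<tau>) \<in> borel_measurable half_line"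
      by simp
  qed (use neg that in auto)
  have der: "((\<lambda>t. exp t * u x t) has_real_derivative exp \<tau> * hconv (\<lambda>y. u y \<tau>) x) (at \<tau>)"
    if "0 < \<tau>" for \<tau>
  proof -
    have "(u x has_real_derivative (conv J (\<lambda>y. u y \<tau>) x - u x \<tau>)) (at \<tau>)"
      using u x that by (simp add: evolution_solution_def)
    then have "(u x has_real_derivative (hconv (\<lambda>y. u y \<tau>) x - u x \<tau>)) (at \<tau>)"
      by (simp only: conv[OF that])
    then have "((\<lambda>t. exp t * u x t) has_real_derivative
        exp \<tau> * u x \<tau> + (hconv (\<lambda>y. u y \<tau>) x - u x \<tau>) * exp \<tau>) (at \<tau>)"
      by (intro DERIV_mult DERIV_exp)
    then show ?thesis by (simp add: algebra_simps)
  qed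
  have "continuous_on {0..} (\<lambda>\<tau>. case (\<tau>, x) of (t, x) \<Rightarrow> hconv (\<lambda>y. u y t) x)"
    by (rule continuous_on_compose2[OF hconv_jointly_continuous[OF cu]])
      (auto intro!: continuous_intros)
  then have c: "continuous_on {0<..} (\<lambda>\<tau>. exp \<tau> * hconv (\<lambda>y. u y \<tau>) x)"
    by (intro continuous_intros) (auto intro: continuous_on_subset)
  have "(LINT \<tau>|lborel. exp \<tau> * hconv (\<lambda>y. u y \<tau>) x * indicator {s..t} \<tau>)
      = exp t * u x t - exp s * u x s"
  proof (rule integral_FTC_Icc_real)
    show "isCont (\<lambda>\<tau>. exp \<tau> * hconv (\<lambda>y. u y \<tau>) x) \<tau>" if "s \<le> \<tau>" for \<tau>
      using c that s by (simp add: continuous_on_eq_continuous_at)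
  qed (use s der in auto)
  then show ?thesis
    by (simp add: integral_restrict_space mult_ac)
qed

text \<open>Multiply the variation-of-constants formula by \<open>\<phi>\<close>, integrate over \<open>x\<close>, and exchange the integrals
  over time and space; the inner space integral is then \<open>\<integral> (K u) \<phi> = \<integral> u (K \<phi>) = \<integral> u \<phi>\<close>.\<close>

lemma pairing_increment:
  assumes u: "evolution_solution J u0 u" and phi: "stationary_solution J d \<phi>"
    and s: "0 < s" "s \<le> t"
  defines "F \<equiv> \<lambda>t. LINT x|half_line. u x t * \<phi> x"
  shows "exp t * F t - exp s * F s = integral {s..t} (\<lambda>\<tau>. exp \<tau> * F \<tau>)"
proof -
  let ?T = "restrict_space lborel {s..t}"
  let ?N = "\<lambda>\<tau>. LINT x|weighted_half_line. \<bar>u x \<tau>\<bar>"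
  let ?f = "\<lambda>(\<tau>, x). exp \<tau> * hconv (\<lambda>y. u y \<tau>) x * \<phi> x"
  have cu: "continuous_into_L1 weighted_half_line {0..} (\<lambda>t x. u x t)"
    using u by (simp add: evolution_solution_def)
  obtain C where C: "linear_growth C \<phi>"
    using phi by (rule stationary_linear_growth)
  then have [measurable]: "\<phi> \<in> borel_measurable half_line" and C0: "0 \<le> C"
    by (auto simp: linear_growth_def)
  have int: "integrable weighted_half_line (\<lambda>x. u x \<tau>)" if "0 \<le> \<tau>" for \<tau>
    using cu that by (simp add: continuous_into_L1_def)
  interpret H: sigma_finite_measure half_line by (rule sigma_finite_half_line)
  interpret T: finite_measure ?T
    by (rule finite_measureI) (use s in \<open>simp add: emeasure_restrict_space space_restrict_space\<close>)
  interpret TH: pair_sigma_finite ?T half_line ..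
  have "compact (?N ` {s..t})"
    using continuous_on_L1_norm[OF cu] s
    by (intro compact_continuous_image) (auto intro: continuous_on_subset)
  then obtain B where B: "\<And>\<tau>. \<tau> \<in> {s..t} \<Longrightarrow> ?N \<tau> \<le> B"
    by (fastforce dest!: compact_imp_bounded simp: bounded_iff)
  \<comment> \<open>The function \<open>\<phi>\<close> is only Lebesgue measurable, so the product must use \<open>half_line\<close>, and
    the Borel measurable function \<open>K u\<close> is transported there along the identity.\<close>
  have "continuous_on ({s..t} \<times> UNIV) (\<lambda>(\<tau>, x). hconv (\<lambda>y. u y \<tau>) x)"
    by (rule continuous_on_subset[OF hconv_jointly_continuous[OF cu]]) (use s in auto)
  then have "(\<lambda>(\<tau>, x). hconv (\<lambda>y. u y \<tau>) x) \<in> borel_measurable (restrict_space borel ({s..t} \<times> UNIV))"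
    by (rule borel_measurable_continuous_on_restrict)
  moreover have "(\<lambda>p. p) \<in> ?T \<Otimes>\<^sub>M half_line \<rightarrow>\<^sub>M restrict_space borel ({s..t} \<times> UNIV)"
  proof (rule measurable_restrict_space2)
    show "(\<lambda>p. p) \<in> space (?T \<Otimes>\<^sub>M half_line) \<rightarrow> {s..t} \<times> UNIV"
      by (auto simp: space_pair_measure space_restrict_space)
    have "(\<lambda>p. (fst p, snd p)) \<in> ?T \<Otimes>\<^sub>M half_line \<rightarrow>\<^sub>M borel \<Otimes>\<^sub>M borel"
      by (intro measurable_Pair measurable_compose[OF measurable_fst] measurable_compose[OF measurable_snd]
          measurable_restrict_space1 measurable_ident_half_line) auto
    then show "(\<lambda>p. p) \<in> borel_measurable (?T \<Otimes>\<^sub>M half_line)"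
      by (simp add: borel_prod)
  qed
  ultimately have hm: "(\<lambda>(\<tau>, x). hconv (\<lambda>y. u y \<tau>) x) \<in> borel_measurable (?T \<Otimes>\<^sub>M half_line)"
    by (rule measurable_compose[rotated])
  have "(\<lambda>p. exp (fst p) * (case p of (\<tau>, x) \<Rightarrow> hconv (\<lambda>y. u y \<tau>) x) * \<phi> (snd p)) \<in> borel_measurable (?T \<Otimes>\<^sub>M half_line)"
  proof (intro borel_measurable_times hm)
    show "(\<lambda>p. exp (fst p)) \<in> borel_measurable (?T \<Otimes>\<^sub>M half_line)"
      by (rule measurable_compose[OF measurable_fst]) (intro measurable_restrict_space1, simp)
  qed measurable
  then have fm [measurable]: "?f \<in> borel_measurable (?T \<Otimes>\<^sub>M half_line)"
    by (simp add: case_prod_beta)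
  have "integrable (?T \<Otimes>\<^sub>M half_line) ?f"
  proof (rule TH.Fubini_integrable[OF fm])
    show "integrable ?T (\<lambda>\<tau>. LINT x|half_line. norm (?f (\<tau>, x)))"
    proof (rule T.integrable_const_bound[of _ "exp t * (C * (1 + d) * B)"])
      show "AE \<tau> in ?T. norm (LINT x|half_line. norm (?f (\<tau>, x))) \<le> exp t * (C * (1 + d) * B)"
      proof (rule AE_I2)
        fix \<tau> assume "\<tau> \<in> space ?T"
        then have \<tau>: "s \<le> \<tau>" "\<tau> \<le> t" by (auto simp: space_restrict_space)
        have "(LINT x|half_line. \<bar>hconv (\<lambda>y. u y \<tau>) x * \<phi> x\<bar>) \<le> C * (1 + d) * ?N \<tau>"
          using hconv_pairing_abs_le[OF int C] \<tau> s by simp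
        also have "\<dots> \<le> C * (1 + d) * B"
          using B \<tau> C0 d_pos by (intro mult_left_mono) auto
        finally have "exp \<tau> * (LINT x|half_line. \<bar>hconv (\<lambda>y. u y \<tau>) x * \<phi> x\<bar>) \<le> exp t * (C * (1 + d) * B)"
          using \<tau> by (intro mult_mono) auto
        moreover have "norm (LINT x|half_line. norm (?f (\<tau>, x)))
            = exp \<tau> * (LINT x|half_line. \<bar>hconv (\<lambda>y. u y \<tau>) x * \<phi> x\<bar>)"
          by (simp add: abs_mult mult.assoc)
        ultimately show "norm (LINT x|half_line. norm (?f (\<tau>, x))) \<le> exp t * (C * (1 + d) * B)"
          by simp
      qed
      show "(\<lambda>\<tau>. LINT x|half_line. norm (?f (\<tau>, x))) \<in> borel_measurable ?T"
        by measurable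
    qed
    show "AE \<tau> in ?T. integrable half_line (\<lambda>x. ?f (\<tau>, x))"
    proof (rule AE_I2)
      fix \<tau> assume "\<tau> \<in> space ?T"
      then have "0 \<le> \<tau>" using s by (auto simp: space_restrict_space)
      then show "integrable half_line (\<lambda>x. ?f (\<tau>, x))"
        using hconv_adjoint(1)[OF int C] by (simp add: mult.assoc)
    qed
  qed
  note swap = TH.Fubini_integral[OF this]
  have L: "(LINT \<tau>|?T. exp \<tau> * hconv (\<lambda>y. u y \<tau>) x * \<phi> x) = exp t * (u x t * \<phi> x) - exp s * (u x s * \<phi> x)"
    if "x \<in> space half_line" for x
  proof -
    have "(LINT \<tau>|?T. exp \<tau> * hconv (\<lambda>y. u y \<tau>) x * \<phi> x)
        = (LINT \<tau>|?T. exp \<tau> * hconv (\<lambda>y. u y \<tau>) x) * \<phi> x"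
      by (rule integral_mult_left_zero)
    also have "\<dots> = (exp t * u x t - exp s * u x s) * \<phi> x"
      using variation_of_constants[OF u _ s, of x] that by simp
    finally show ?thesis by (simp add: algebra_simps)
  qed
  have R: "(LINT x|half_line. exp \<tau> * hconv (\<lambda>y. u y \<tau>) x * \<phi> x) = exp \<tau> * F \<tau>"
    if "\<tau> \<in> space ?T" for \<tau>
  proof -
    have "0 \<le> \<tau>" using that s by (auto simp: space_restrict_space)
    then have "(LINT x|half_line. hconv (\<lambda>y. u y \<tau>) x * \<phi> x) = (LINT x|half_line. u x \<tau> * hconv \<phi> x)"
      using hconv_adjoint(2)[OF int C] by simp
    also have "\<dots> = F \<tau>"
      unfolding F_def by (rule Bochner_Integration.integral_cong) (auto simp: stationary_hconv[OF phi])
    finally show ?thesis by (simp add: mult.assoc)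
  qed
  have "exp t * F t - exp s * F s
      = (LINT x|half_line. exp t * (u x t * \<phi> x) - exp s * (u x s * \<phi> x))"
    using linear_growth_pairing(1)[OF int C] s by (simp add: F_def)
  also have "\<dots> = (LINT x|half_line. LINT \<tau>|?T. exp \<tau> * hconv (\<lambda>y. u y \<tau>) x * \<phi> x)"
    by (intro Bochner_Integration.integral_cong refl L[symmetric])
  also have "\<dots> = (LINT \<tau>|?T. LINT x|half_line. exp \<tau> * hconv (\<lambda>y. u y \<tau>) x * \<phi> x)"
    by (rule swap)
  also have "\<dots> = (LINT \<tau>|?T. exp \<tau> * F \<tau>)"
    by (intro Bochner_Integration.integral_cong) (auto simp: R)
  also have "\<dots> = (LINT \<tau>:{s..t}|lborel. exp \<tau> * F \<tau>)"
    by (simp add: integral_restrict_space set_lebesgue_integral_def)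
  also have "\<dots> = integral {s..t} (\<lambda>\<tau>. exp \<tau> * F \<tau>)"
  proof (rule set_borel_integral_eq_integral)
    have "continuous_on {0..} F"
      unfolding F_def by (rule continuous_on_linear_growth_pairing[OF cu C])
    then show "set_integrable lborel {s..t} (\<lambda>\<tau>. exp \<tau> * F \<tau>)"
      using s by (intro borel_integrable_atLeastAtMost' continuous_intros) (auto intro: continuous_on_subset)
  qed
  finally show ?thesis .
qed

end

text \<open>The equation makes \<open>e\<^sup>t F t\<close> a primitive of itself, so \<open>F\<close> has derivative zero on positive times;
  continuity carries the constant to time \<open>0\<close>.\<close>

lemma constant_if_exp_integral_equation:
  fixes F :: "real \<Rightarrow> real"
  assumes cont: "continuous_on {0..} F"
    and inc: "\<And>s t. 0 < s \<Longrightarrow> s \<le> t \<Longrightarrow>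
      exp t * F t - exp s * F s = integral {s..t} (\<lambda>\<tau>. exp \<tau> * F \<tau>)"
    and t: "0 < t"
  shows "F t = F 0"
proof -
  have pos: "F s = F t" if s: "0 < s" "s \<le> t" for s
  proof -
    let ?G = "\<lambda>\<tau>. exp \<tau> * F \<tau>"
    have "\<exists>c. \<forall>r\<in>{s..t}. F r = c"
    proof (rule has_vector_derivative_zero_constant)
      fix r assume r: "r \<in> {s..t}"
      have "continuous_on {s..t} ?G"
        using s by (intro continuous_intros) (auto intro: continuous_on_subset[OF cont])
      then have "((\<lambda>r. integral {s..r} ?G) has_vector_derivative ?G r) (at r within {s..t})"
        using r by (rule integral_has_vector_derivative)
      then have dI: "((\<lambda>r. integral {s..r} ?G) has_real_derivative ?G r) (at r within {s..t})"
        by (simp add: has_real_derivative_iff_has_vector_derivative)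
      have "((\<lambda>r. exp (- r)) has_real_derivative - exp (- r)) (at r within {s..t})"
        by (auto intro!: derivative_eq_intros)
      moreover have "((\<lambda>r. exp s * F s + integral {s..r} ?G) has_real_derivative 0 + ?G r) (at r within {s..t})"
        by (intro DERIV_add DERIV_const dI)
      ultimately have "((\<lambda>r. exp (- r) * (exp s * F s + integral {s..r} ?G)) has_real_derivative
          exp (- r) * (0 + ?G r) + - exp (- r) * (exp s * F s + integral {s..r} ?G)) (at r within {s..t})"
        by (rule DERIV_mult')
      moreover have eq: "exp (- r) * (exp s * F s + integral {s..r} ?G) = F r" if "r \<in> {s..t}" for r
      proof -
        have "exp s * F s + integral {s..r} ?G = exp r * F r"
          using inc[of s r] that s by simp
        then show ?thesis by (simp only: exp_minus) simp
      qed
      moreover have "exp (- r) * ?G r = F r"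
        by (simp add: exp_minus)
      ultimately have "((\<lambda>r. exp (- r) * (exp s * F s + integral {s..r} ?G)) has_vector_derivative 0) (at r within {s..t})"
        using r by (simp add: has_real_derivative_iff_has_vector_derivative)
      then show "(F has_vector_derivative 0) (at r within {s..t})"
        using r by (rule has_vector_derivative_transform[rotated -1]) (use eq in auto)
    qed auto
    then show ?thesis using s by auto
  qed
  have "(F \<longlongrightarrow> F 0) (at 0 within {0..})"
    using cont by (simp add: continuous_on_def)
  then have "(F \<longlongrightarrow> F 0) (at_right 0)"
    by (rule tendsto_within_subset) auto
  moreover have "(F \<longlongrightarrow> F t) (at_right 0)"
  proof (rule tendsto_eventually)
    have "eventually (\<lambda>s. s \<in> {0<..<t}) (at_right 0)"
      using t by (rule eventually_at_right_real)
    then show "eventually (\<lambda>s. F s = F t) (at_right 0)"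
      by eventually_elim (rule pos, auto)
  qed
  ultimately show ?thesis
    using tendsto_unique trivial_limit_at_right_real by blast
qed

theorem proposition3p1:
  fixes J u0 \<phi> :: "real \<Rightarrow> real" and u :: "real \<Rightarrow> real \<Rightarrow> real" and d :: real
  assumes J_nonneg: "\<And>z. J z \<ge> 0"
    and J_smooth: "smooth J"
    and J_even: "\<And>z. J (- z) = J z"
    and J_integral: "(LINT z|lebesgue. J z) = 1"
    and d_pos: "d > 0"
    and J_support: "\<And>z. \<bar>z\<bar> \<ge> d \<Longrightarrow> J z = 0"
    and u0_nonneg: "\<And>x. u0 x \<ge> 0"
    and u0_bounded: "bounded (range u0)"
    and u0_neg: "\<And>x. x < 0 \<Longrightarrow> u0 x = 0"
    and u0_moment: "integrable half_line (\<lambda>x. u0 x * (1 + x))"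
    and u_solution: "evolution_solution J u0 u"
    and phi_solution: "stationary_solution J d \<phi>"
  shows "\<forall>t>0. (LINT x|half_line. u x t * \<phi> x) = (LINT x|half_line. u0 x * \<phi> x)"
proof -
  obtain L where "L-lipschitz_on UNIV J"
    using smooth_compact_support_lipschitz[OF J_smooth J_support] by blast
  then interpret lipschitz_kernel J d L
    using assms by unfold_locales auto
  let ?F = "\<lambda>t. LINT x|half_line. u x t * \<phi> x"
  obtain C where "linear_growth C \<phi>"
    using phi_solution by (rule stationary_linear_growth)
  then have "continuous_on {0..} ?F"
    using u_solution by (intro continuous_on_linear_growth_pairing) (simp_all add: evolution_solution_def)
  then have "?F t = ?F 0" if "0 < t" for t
    using pairing_increment[OF u_solution phi_solution] that
    by (rule constant_if_exp_integral_equation)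
  moreover have "u x 0 = u0 x" for x
    using u_solution by (simp add: evolution_solution_def)
  ultimately show ?thesis by simp
qed

end
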